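(* Let $m\ge 0$, let $K>0$, and let $z=(z_1,\dots,z_m)\in\mathbb{C}^m$ be a list of complex numbers closed under complex conjugation (with multiplicity) such that $z_i\notin[0,+\infty)$ for all $i$. For each integer $n>m$ let $$\sigma^\star(z,n)=\inf\ \sigma(H),$$ the infimum being over all $p=(p_1,\dots,p_n)\in\mathbb{C}^n$ closed under complex conjugation (with multiplicity), with $p_i\ne z_j$ for all $i,j$ and $\operatorname{Re}(p_i)<0$ for $i=1,\dots,n$, such that $H(s)=K\prod_{i=1}^m(s-z_i)/\prod_{i=1}^n(s-p_i)$ is externally positive. (1) If at least one of the $z_i$ is a real negative number, then $$\min_{n}\sigma^\star(z,n)=\max_{z_i\in\mathbb{R}}\{z_i\}.$$ (2) If none of the $z_i$ is a real negative number, then $\lim_{n\to+\infty}\sigma^\star(z,n)=-\infty$.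
   Context: All transfer functions have real coefficients. The decay rate of $H(s)=K\prod_{i=1}^m(s-z_i)/\prod_{i=1}^n(s-p_i)$ is its pole abscissa $\sigma(H)=\max_i\operatorname{Re}(p_i)$. $H$ is called externally positive if its impulse response $h(t)=\mathfrak{L}^{-1}\{H(s)\}$ (inverse Laplace transform) satisfies $h(t)\ge 0$ for all $t\in[0,+\infty)$. For strictly proper $H$ ($n>m$), $h$ is the continuous function on $[0,\infty)$ with Laplace transform $H$. The value $\sigma^\star(z,n)$ is taken in the extended reals: the infimum of the empty set is $+\infty$, and the value $-\infty$ is allowed. The minimum in (1) is over integers $n>m$. *)

theory Defs
  imports "HOL-Analysis.Analysis" "HOL-Library.Multiset"
begin

definition conj_closed :: "complex list \<Rightarrow> bool" where
  "conj_closed xs \<longleftrightarrow> mset (map cnj xs) = mset xs"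

definition transfer_fun :: "real \<Rightarrow> complex list \<Rightarrow> complex list \<Rightarrow> complex \<Rightarrow> complex" where
  "transfer_fun K zs ps s =
     complex_of_real K * (\<Prod>z\<leftarrow>zs. s - z) / (\<Prod>p\<leftarrow>ps. s - p)"

text \<open>Intended for nonempty lists of poles that are not cancelled by zeros.\<close>

definition pole_abscissa :: "complex list \<Rightarrow> real" where
  "pole_abscissa ps = Max (Re ` set ps)"

text \<open>The integral is taken over the half-line in the Henstock--Kurzweil sense, which includes
  improper (conditionally convergent) integrals; it has to converge to the given function on some
  right half-plane.\<close>

definition has_laplace_transform :: "(real \<Rightarrow> real) \<Rightarrow> (complex \<Rightarrow> complex) \<Rightarrow> bool" where
  "has_laplace_transform h F \<longleftrightarrow>
     (\<exists>a::real. \<forall>s. Re s > a \<longrightarrow>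
        ((\<lambda>t. exp (- (s * complex_of_real t)) * complex_of_real (h t)) has_integral F s) {0..})"

text \<open>For strictly proper transfer functions. The impulse response is unique on the half-line
  because of continuity; values at negative times are irrelevant.\<close>

definition is_impulse_response :: "(real \<Rightarrow> real) \<Rightarrow> (complex \<Rightarrow> complex) \<Rightarrow> bool" where
  "is_impulse_response h F \<longleftrightarrow> continuous_on {0..} h \<and> has_laplace_transform h F"

definition externally_positive :: "(complex \<Rightarrow> complex) \<Rightarrow> bool" where
  "externally_positive F \<longleftrightarrow> (\<exists>h. is_impulse_response h F \<and> (\<forall>t\<ge>0. h t \<ge> 0))"

definition admissible_poles :: "real \<Rightarrow> complex list \<Rightarrow> nat \<Rightarrow> complex list set" where
  "admissible_poles K zs n =
     {ps. length ps = n \<and> conj_closed ps \<and> set ps \<inter> set zs = {} \<and> (\<forall>p\<in>set ps. Re p < 0) \<and>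
          externally_positive (transfer_fun K zs ps)}"

text \<open>Only meaningful for \<open>n > length zs\<close>.\<close>

definition sigma_star :: "real \<Rightarrow> complex list \<Rightarrow> nat \<Rightarrow> ereal" where
  "sigma_star K zs n = (INF ps\<in>admissible_poles K zs n. ereal (pole_abscissa ps))"

end

theory Submission
  imports Defs "HOL-Complex_Analysis.Complex_Analysis"
begin

text \<open>
  Lower bound: if \<open>h \<ge> 0\<close>, the Taylor coefficients of \<open>x \<mapsto> H (s0 - x)\<close> at \<open>0\<close> are the moments
  \<open>\<integral> t^k / k! * exp (- s0 t) h t dt \<ge> 0\<close>, and the series converges up to the nearest pole. Hence
  \<open>H x \<ge> H s0 > 0\<close> for all real \<open>x\<close> in \<open>(\<sigma>(H), s0]\<close>, so that no real zero exceeds \<open>\<sigma>(H)\<close>.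

  Upper bound: put all \<open>n\<close> poles at one real \<open>p\<close> larger than every real zero. In \<open>w = 1 / (s - p)\<close>,
  \<open>H\<close> is a product of factors \<open>w (1 + (p - z) w)\<close> for real \<open>z\<close> and, for conjugate pairs,
  \<open>w^(k+1) (1 + (p - z) w) (1 + (p - cnj z) w)\<close>, whose inverse transform is \<open>exp (p t) t^k\<close> times a
  quadratic with nonpositive discriminant once \<open>k\<close> is large. Convolution preserves nonnegativity,
  and \<open>k\<close> can be chosen uniformly for bounded \<open>p\<close>, so \<open>p\<close> may tend to the largest real zero for a
  fixed \<open>n\<close>, or be arbitrarily negative if there are no real zeros.
\<close>

section \<open>Laplace and convolution integrals of normalized monomials\<close>

lemma power_div_fact_le_exp:
  fixes x :: real
  assumes "x \<ge> 0"
  shows "x ^ k / fact k \<le> exp x"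
proof -
  have "(\<Sum>i\<in>{k}. x ^ i / fact i) \<le> (\<Sum>i. x ^ i / fact i)"
    by (rule sum_le_suminf) (use assms summable_exp[of x] in \<open>auto simp: field_simps\<close>)
  then show ?thesis
    by (simp add: exp_def field_simps scaleR_conv_of_real)
qed

lemma has_real_derivative_monom_fact:
  "((\<lambda>u. u ^ Suc k / fact (Suc k)) has_real_derivative u ^ k / fact k) (at u within S)"
proof -
  have "((\<lambda>u. u ^ Suc k / fact (Suc k)) has_real_derivative
          (real (Suc k) * u ^ k) / fact (Suc k)) (at u within S)"
    by (rule DERIV_cdivide) (rule derivative_eq_intros refl | simp)+
  then show ?thesis
    by (simp add: field_simps del: of_nat_Suc)
qed

text \<open>Euler's Beta integral, by integration by parts: each step in \<open>b\<close> moves one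
  power from \<open>t - u\<close> to \<open>u\<close>. It computes the convolution of two normalized
  monomials.\<close>

lemma has_integral_beta_monom:
  fixes t :: real
  assumes "t \<ge> 0"
  shows "((\<lambda>u. u ^ a / fact a * ((t - u) ^ b / fact b)) has_integral
            t ^ (a + b + 1) / fact (a + b + 1)) {0..t}"
proof (induction b arbitrary: a)
  case 0
  have "((\<lambda>u. u ^ a / fact a * ((t - u) ^ 0 / fact 0)) has_integral
          t ^ Suc a / fact (Suc a) - 0 ^ Suc a / fact (Suc a)) {0..t}"
  proof (rule fundamental_theorem_of_calculus)
    fix u
    show "((\<lambda>u. u ^ Suc a / fact (Suc a)) has_vector_derivative u ^ a / fact a * ((t - u) ^ 0 / fact 0))
            (at u within {0..t})"
      using has_real_derivative_monom_fact[of a u "{0..t}"]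
      by (simp flip: has_real_derivative_iff_has_vector_derivative)
  qed (use assms in auto)
  then show ?case by simp
next
  case (Suc b)
  let ?J = "\<lambda>u. u ^ Suc a / fact (Suc a) * ((t - u) ^ b / fact b)"
  let ?P = "\<lambda>u. u ^ Suc a / fact (Suc a) * ((t - u) ^ Suc b / fact (Suc b))"
  \<comment> \<open>The boundary terms vanish: \<open>?P\<close> has the factor \<open>u\<close> at
    \<open>0\<close> and the factor \<open>t - u\<close> at \<open>t\<close>.\<close>
  have "((\<lambda>u. u ^ a / fact a * ((t - u) ^ Suc b / fact (Suc b)) - ?J u) has_integral ?P t - ?P 0) {0..t}"
  proof (rule fundamental_theorem_of_calculus)
    fix u
    note A = has_real_derivative_monom_fact[of a u "{0..t}"]
    have B: "((\<lambda>u. (t - u) ^ Suc b / fact (Suc b)) has_real_derivative - ((t - u) ^ b / fact b))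
               (at u within {0..t})"
      by (rule DERIV_chain'[OF _ has_real_derivative_monom_fact, THEN DERIV_cong])
         (auto intro!: derivative_eq_intros)
    show "(?P has_vector_derivative u ^ a / fact a * ((t - u) ^ Suc b / fact (Suc b)) - ?J u)
            (at u within {0..t})"
      using DERIV_mult[OF A B]
      by (simp flip: has_real_derivative_iff_has_vector_derivative add: mult_ac)
  qed (use assms in auto)
  from has_integral_add[OF this Suc[of "Suc a"]] show ?case
    by simp
qed

text \<open>Integration by parts gives the recursion \<open>G_(k+1) = (G_k - e_(k+1)) / w\<close>
  for antiderivatives that vanish at infinity, so a closed form can be avoided; the value at
  \<open>0\<close> picks up a factor \<open>1 / w\<close> each time.\<close>

lemma laplace_monom_antiderivative:
  fixes w :: complex
  assumes w: "Re w > 0"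
  shows "\<exists>G. (\<forall>t. (G has_vector_derivative exp (- (w * of_real t)) * of_real (t ^ k / fact k)) (at t)) \<and>
              G 0 = - (1 / w ^ Suc k) \<and> (G \<longlongrightarrow> 0) at_top"
proof -
  let ?e = "\<lambda>k t. exp (- (w * of_real t)) * of_real (t ^ k / fact k) :: complex"
  have lim: "(?e k \<longlongrightarrow> 0) at_top" for k
  proof (rule tendsto_norm_zero_cancel)
    have "((\<lambda>t. (1 / (Re w) ^ k) * ((Re w * t) ^ k / exp (Re w * t)) / fact k) \<longlongrightarrow> 1 / (Re w)^k * 0 / fact k) at_top"
      by (intro tendsto_intros filterlim_compose[OF tendsto_power_div_exp_0]
          filterlim_tendsto_pos_mult_at_top[OF tendsto_const w] filterlim_ident) auto
    then have "((\<lambda>t. exp (- Re w * t) * t ^ k / fact k) \<longlongrightarrow> 0) at_top"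
      using w by (simp add: power_mult_distrib exp_minus field_simps)
    then show "((\<lambda>t. norm (?e k t)) \<longlongrightarrow> 0) at_top"
      by (rule Lim_transform_eventually)
        (use eventually_ge_at_top[of 0] in eventually_elim, simp add: norm_mult norm_divide norm_power)
  qed
  have w0: "w \<noteq> 0" using w by auto
  have dexp: "((\<lambda>t. exp (- (w * of_real t))) has_vector_derivative - w * exp (- (w * of_real t))) (at t)" for t
  proof -
    have "((\<lambda>t. exp (- (w * t))) has_field_derivative - w * exp (- (w * of_real t))) (at (of_real t))"
      by (auto intro!: derivative_eq_intros)
    then show ?thesis
      using has_vector_derivative_real_field by fastforce
  qed
  show ?thesis
  proof (induction k)
    case 0
    show ?case
    proof (intro exI[of _ "\<lambda>t. - (1/w) * exp (- (w * of_real t))"] conjI allI)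
      fix t
      show "((\<lambda>t. - (1/w) * exp (- (w * of_real t))) has_vector_derivative ?e 0 t) (at t)"
        using has_vector_derivative_mult_right[OF dexp, of "- (1/w)" t] w0 by simp
      show "((\<lambda>t. - (1/w) * exp (- (w * of_real t))) \<longlongrightarrow> 0) at_top"
        using tendsto_mult_right_zero[OF lim[of 0], of "- (1/w)"] by simp
    qed auto
  next
    case (Suc k)
    then obtain G where G: "\<And>t. (G has_vector_derivative ?e k t) (at t)"
      "G 0 = - (1 / w ^ Suc k)" "(G \<longlongrightarrow> 0) at_top" by blast
    show ?case
    proof (intro exI[of _ "\<lambda>t. (1/w) * (G t - ?e (Suc k) t)"] conjI allI)
      fix t :: real
      note P = has_real_derivative_monom_fact[of k t UNIV]
      have "((\<lambda>t. of_real (t ^ Suc k / fact (Suc k)) :: complex) has_vector_derivative of_real (t ^ k / fact k)) (at t)"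
        using P has_vector_derivative_of_real has_real_derivative_iff_has_vector_derivative by blast
      from has_vector_derivative_mult[OF dexp this]
      have "(?e (Suc k) has_vector_derivative ?e k t - w * ?e (Suc k) t) (at t)"
        by (simp add: algebra_simps)
      from has_vector_derivative_mult_right[OF has_vector_derivative_diff[OF G(1) this], of "1/w"]
      show "((\<lambda>t. (1/w) * (G t - ?e (Suc k) t)) has_vector_derivative ?e (Suc k) t) (at t)"
        using w0 by simp
      show "((\<lambda>t. (1/w) * (G t - ?e (Suc k) t)) \<longlongrightarrow> 0) at_top"
        using tendsto_mult[OF tendsto_const[of "1/w"] tendsto_diff[OF G(3) lim[of "Suc k"]]] by simp
    qed (use G(2) in auto)
  qed
qed

text \<open>The antiderivative evaluates the integral over \<open>{0..n}\<close>; dominated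
  convergence passes to the half-line.\<close>

lemma has_integral_laplace_monom:
  fixes w :: complex
  assumes w: "Re w > 0"
  shows "((\<lambda>t. exp (- (w * of_real t)) * of_real (t ^ k / fact k)) has_integral 1 / w ^ Suc k) {0..}"
proof -
  let ?e = "\<lambda>t. exp (- (w * of_real t)) * of_real (t ^ k / fact k) :: complex"
  obtain G where G: "\<And>t. (G has_vector_derivative ?e t) (at t)"
      "G 0 = - (1 / w ^ Suc k)" "(G \<longlongrightarrow> 0) at_top"
    using laplace_monom_antiderivative[OF w, of k] by blast
  \<comment> \<open>One half of the exponential decay absorbs \<open>t ^ k / fact k\<close>, the
    other half remains as an integrable majorant.\<close>
  define d where "d = Re w / 2"
  have d: "d > 0" using w by (simp add: d_def)
  show ?thesis
  proof (rule has_integral_dominated_convergence)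
    fix n :: nat
    have "(?e has_integral G (real n) - G 0) {0..real n}"
      by (rule fundamental_theorem_of_calculus) (use G(1) in \<open>auto intro: has_vector_derivative_at_within\<close>)
    then show "((\<lambda>t. if t \<in> {0..real n} then ?e t else 0) has_integral G (real n) - G 0) {0..}"
      by (subst has_integral_restrict) auto
    have "norm (?e t) \<le> (1 / d ^ k) * exp (- d * t)" if "t \<ge> 0" for t
    proof -
      have "(d * t) ^ k / fact k \<le> exp (d * t)"
        using d that by (intro power_div_fact_le_exp) auto
      then have "t ^ k / fact k \<le> exp (d * t) / d ^ k"
        using d by (simp add: field_simps power_mult_distrib)
      then have "exp (- (Re w * t)) * (t ^ k / fact k) \<le> exp (- (Re w * t)) * (exp (d * t) / d ^ k)"
        by (rule mult_left_mono) auto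
      also have "\<dots> = (1 / d ^ k) * exp (- d * t)"
        by (simp add: d_def flip: exp_add)
      finally show ?thesis
        using that by (simp add: norm_mult norm_divide norm_power)
    qed
    then show "\<forall>t\<in>{0..}. norm (if t \<in> {0..real n} then ?e t else 0) \<le> (1 / d ^ k) * exp (- d * t)"
      using d by auto
  next
    show "(\<lambda>t. (1 / d ^ k) * exp (- d * t)) integrable_on {0..}"
      using has_integral_mult_right[OF has_integral_exp_minus_to_infinity[OF d, of 0]]
      by (blast intro: has_integral_integrable)
  next
    show "\<forall>t\<in>{0..}. (\<lambda>n. if t \<in> {0..real n} then ?e t else 0) \<longlonglongrightarrow> ?e t"
    proof
      fix t :: real assume "t \<in> {0..}"
      obtain N where N: "t \<le> real N" using real_arch_simple by blast
      show "(\<lambda>n. if t \<in> {0..real n} then ?e t else 0) \<longlonglongrightarrow> ?e t"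
        by (rule tendsto_eventually)
          (use eventually_ge_at_top[of N] in eventually_elim, use N \<open>t \<in> {0..}\<close> in auto)
    qed
  next
    have "(\<lambda>n. G (real n)) \<longlonglongrightarrow> 0"
      using G(3) filterlim_compose filterlim_real_sequentially by blast
    from tendsto_diff[OF this tendsto_const[of "G 0"]]
    show "(\<lambda>n. G (real n) - G 0) \<longlonglongrightarrow> 1 / w ^ Suc k"
      by (simp add: G(2))
  qed
qed


section \<open>Polynomials and their transforms in the variable \<open>1 / s\<close>\<close>

text \<open>\<open>F\<close> is the Laplace transform of the polynomial \<open>h\<close> in the variable \<open>w = 1 / s\<close>;
  substituting \<open>w = 1 / (s - p)\<close> instead gives the transform of \<open>exp (p t) h t\<close>.\<close>

inductive transform_pair :: "(real \<Rightarrow> real) \<Rightarrow> (complex \<Rightarrow> complex) \<Rightarrow> bool" where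
  monom: "transform_pair (\<lambda>t. c * (t ^ k / fact k)) (\<lambda>w. of_real c * w ^ Suc k)"
| add: "transform_pair h F \<Longrightarrow> transform_pair g G \<Longrightarrow>
          transform_pair (\<lambda>t. h t + g t) (\<lambda>w. F w + G w)"

text \<open>Both sides are bilinear, so an outer induction on \<open>h\<close> and an inner one on
  \<open>g\<close> reduce the claim to two monomials, where it is the Beta integral. Keeping
  \<open>c\<close> as an integral lets it inherit the sign of \<open>h\<close> and
  \<open>g\<close>.\<close>

lemma transform_pair_convolution:
  assumes "transform_pair h F" "transform_pair g G"
  shows "\<exists>c. transform_pair c (\<lambda>w. F w * G w) \<and>
             (\<forall>t\<ge>0. ((\<lambda>u. h u * g (t - u)) has_integral c t) {0..t})"
  using assms
proof (induction rule: transform_pair.induct)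
  case (monom c k)
  then show ?case
  proof (induction rule: transform_pair.induct)
    case (monom d l)
    have "(\<lambda>w. of_real c * w ^ Suc k * (of_real d * w ^ Suc l)) =
            (\<lambda>w. of_real (c * d) * w ^ Suc (k + l + 1) :: complex)"
      by (auto simp: power_add mult_ac)
    then have "transform_pair (\<lambda>t. (c * d) * (t ^ (k + l + 1) / fact (k + l + 1)))
                 (\<lambda>w. of_real c * w ^ Suc k * (of_real d * w ^ Suc l))"
      using transform_pair.monom by metis
    moreover have "((\<lambda>u. c * (u ^ k / fact k) * (d * ((t - u) ^ l / fact l))) has_integral
                     (c * d) * (t ^ (k + l + 1) / fact (k + l + 1))) {0..t}" if "t \<ge> 0" for t
      using has_integral_mult_right[OF has_integral_beta_monom[OF that], of "c * d" k l]
      by (simp add: mult_ac)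
    ultimately show ?case
      by (intro exI[of _ "\<lambda>t. (c * d) * (t ^ (k + l + 1) / fact (k + l + 1))"]) blast
  next
    case (add h1 F1 h2 F2)
    then obtain c1 c2 where c:
      "transform_pair c1 (\<lambda>w. of_real c * w ^ Suc k * F1 w)"
      "\<And>t. t \<ge> 0 \<Longrightarrow> ((\<lambda>u. c * (u ^ k / fact k) * h1 (t - u)) has_integral c1 t) {0..t}"
      "transform_pair c2 (\<lambda>w. of_real c * w ^ Suc k * F2 w)"
      "\<And>t. t \<ge> 0 \<Longrightarrow> ((\<lambda>u. c * (u ^ k / fact k) * h2 (t - u)) has_integral c2 t) {0..t}"
      by blast
    show ?case
      using transform_pair.add[OF c(1,3)] has_integral_add[OF c(2,4)]
      by (intro exI[of _ "\<lambda>t. c1 t + c2 t"]) (simp add: distrib_left)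
  qed
next
  case (add h1 F1 h2 F2)
  then obtain c1 c2 where c:
    "transform_pair c1 (\<lambda>w. F1 w * G w)"
    "\<And>t. t \<ge> 0 \<Longrightarrow> ((\<lambda>u. h1 u * g (t - u)) has_integral c1 t) {0..t}"
    "transform_pair c2 (\<lambda>w. F2 w * G w)"
    "\<And>t. t \<ge> 0 \<Longrightarrow> ((\<lambda>u. h2 u * g (t - u)) has_integral c2 t) {0..t}"
    by blast
  show ?case
    using transform_pair.add[OF c(1,3)] has_integral_add[OF c(2,4)]
    by (intro exI[of _ "\<lambda>t. c1 t + c2 t"]) (simp add: distrib_right)
qed

lemma transform_pair_continuous_on:
  "transform_pair h F \<Longrightarrow> continuous_on A h"
  by (induction rule: transform_pair.induct) (auto intro!: continuous_intros)

lemma transform_pair_laplace: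
  assumes "transform_pair h F" "Re s > p"
  shows "((\<lambda>t. exp (- (s * of_real t)) * of_real (exp (p * t) * h t)) has_integral
            F (1 / (s - of_real p))) {0..}"
  using assms
proof (induction rule: transform_pair.induct)
  case (monom c k)
  then have "Re (s - of_real p) > 0" by simp
  from has_integral_mult_right[OF has_integral_laplace_monom[OF this, of k], of "of_real c"]
  have "((\<lambda>t. of_real c * (exp (- ((s - of_real p) * of_real t)) * of_real (t ^ k / fact k)))
          has_integral of_real c * (1 / (s - of_real p)) ^ Suc k) {0..}"
    by (simp add: power_one_over)
  moreover have eq: "of_real c * (exp (- ((s - of_real p) * of_real t)) * of_real (t ^ k / fact k)) =
        exp (- (s * of_real t)) * of_real (exp (p * t) * (c * (t ^ k / fact k)))" for t
    by (simp add: exp_of_real algebra_simps flip: exp_add exp_of_real)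
  ultimately show ?case by (simp only: eq)
next
  case (add h F g G)
  then show ?case
    using has_integral_add[OF add.IH(1,2)] by (simp add: algebra_simps)
qed

section \<open>Factors with nonnegative inverse transform\<close>

text \<open>The factor \<open>exp (p * t)\<close> is positive and does not affect the sign, so it is
  left out here and restored only when the transfer function is assembled.\<close>

definition positive_transform :: "(complex \<Rightarrow> complex) \<Rightarrow> bool" where
  "positive_transform F \<longleftrightarrow> (\<exists>h. transform_pair h F \<and> (\<forall>t\<ge>0. h t \<ge> 0))"

lemma positive_transform_monom:
  "c \<ge> 0 \<Longrightarrow> positive_transform (\<lambda>w. of_real c * w ^ Suc k)"
  unfolding positive_transform_def
  by (intro exI[of _ "\<lambda>t. c * (t ^ k / fact k)"] conjI transform_pair.monom) auto

lemma positive_transform_add: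
  assumes "positive_transform F" "positive_transform G"
  shows "positive_transform (\<lambda>w. F w + G w)"
proof -
  obtain h g where "transform_pair h F" "\<forall>t\<ge>0. h t \<ge> 0" "transform_pair g G" "\<forall>t\<ge>0. g t \<ge> 0"
    using assms unfolding positive_transform_def by blast
  then show ?thesis
    unfolding positive_transform_def
    by (intro exI[of _ "\<lambda>t. h t + g t"] conjI transform_pair.add) auto
qed

lemma positive_transform_mult:
  assumes "positive_transform F" "positive_transform G"
  shows "positive_transform (\<lambda>w. F w * G w)"
proof -
  obtain h g where h: "transform_pair h F" "\<forall>t\<ge>0. h t \<ge> 0" and g: "transform_pair g G" "\<forall>t\<ge>0. g t \<ge> 0"
    using assms unfolding positive_transform_def by blast
  obtain c where c: "transform_pair c (\<lambda>w. F w * G w)"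
    "\<And>t. t \<ge> 0 \<Longrightarrow> ((\<lambda>u. h u * g (t - u)) has_integral c t) {0..t}"
    using transform_pair_convolution[OF h(1) g(1)] by blast
  have "c t \<ge> 0" if "t \<ge> 0" for t
    by (rule has_integral_nonneg[OF c(2)[OF that]]) (use h(2) g(2) in auto)
  with c(1) show ?thesis
    unfolding positive_transform_def by blast
qed

text \<open>Extra poles at the same point preserve positivity, so what holds for one
  \<open>n\<close> holds for all larger ones. The case \<open>j = 0\<close> is separate because
  monomials transform to powers of \<open>w\<close> with exponent at least one.\<close>

lemma positive_transform_mult_power:
  assumes "positive_transform F"
  shows "positive_transform (\<lambda>w. F w * w ^ j)"
proof (cases j)
  case (Suc k)
  then show ?thesis
    using positive_transform_mult[OF assms positive_transform_monom[of 1 k]] by simp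
qed (use assms in simp)

lemma positive_transform_real_zero:
  assumes "z \<le> p"
  shows "positive_transform (\<lambda>w. w * (1 + (of_real p - of_real z) * w))"
proof -
  have eq: "of_real 1 * w ^ Suc 0 + of_real (p - z) * w ^ Suc 1 = w * (1 + (of_real p - of_real z) * w)"
    for w :: complex
    by (simp add: algebra_simps)
  have "positive_transform (\<lambda>w. of_real 1 * w ^ Suc 0 + of_real (p - z) * w ^ Suc 1)"
    using assms by (intro positive_transform_add positive_transform_monom) auto
  then show ?thesis by (simp only: eq)
qed

text \<open>The inverse transform is \<open>t ^ k / fact k\<close> times a quadratic in
  \<open>t\<close>. The hypothesis is the condition that its discriminant is not positive:
  \<open>u\<^sup>2 * (k + 2) \<le> (u\<^sup>2 + v\<^sup>2) * (k + 1)\<close> with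
  \<open>u = p - Re z\<close> and \<open>v = Im z\<close>.\<close>

lemma positive_transform_conjugate_zeros:
  assumes "(p - Re z)\<^sup>2 \<le> (Im z)\<^sup>2 * (real k + 1)"
  shows "positive_transform (\<lambda>w. w ^ Suc k * ((1 + (of_real p - z) * w) * (1 + (of_real p - cnj z) * w)))"
proof -
  define u v where "u = p - Re z" and "v = Im z"
  define D where "D = u\<^sup>2 + v\<^sup>2"
  let ?h = "\<lambda>t. 1 * (t ^ k / fact k) + (2 * u) * (t ^ Suc k / fact (Suc k))
                 + D * (t ^ Suc (Suc k) / fact (Suc (Suc k)))"
  have sum: "(of_real p - z) + (of_real p - cnj z) = of_real (2 * u)"
    by (rule complex_eqI) (simp_all add: u_def)
  have prod: "(of_real p - z) * (of_real p - cnj z) = of_real D"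
    by (rule complex_eqI) (simp_all add: u_def v_def D_def power2_eq_square)
  \<comment> \<open>Expanding with generic \<open>a\<close>, \<open>b\<close> exposes their sum and
    product, which are real for a conjugate pair.\<close>
  have "w ^ Suc k * ((1 + a * w) * (1 + b * w)) =
      of_real 1 * w ^ Suc k + (a + b) * w ^ Suc (Suc k) + (a * b) * w ^ Suc (Suc (Suc k))" for a b w :: complex
    by (simp add: ring_distribs mult_ac)
  from this[where a = "of_real p - z" and b = "of_real p - cnj z", unfolded sum prod]
  have eq: "w ^ Suc k * ((1 + (of_real p - z) * w) * (1 + (of_real p - cnj z) * w)) =
      of_real 1 * w ^ Suc k + of_real (2 * u) * w ^ Suc (Suc k) + of_real D * w ^ Suc (Suc (Suc k))" for w
    .
  have tp: "transform_pair ?h (\<lambda>w. of_real 1 * w ^ Suc k + of_real (2 * u) * w ^ Suc (Suc k)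
                      + of_real D * w ^ Suc (Suc (Suc k)))"
    by (intro transform_pair.intros)
  have nonneg: "?h t \<ge> 0" if "t \<ge> 0" for t
  proof -
    \<comment> \<open>The ratios of consecutive factorials; the quadratic is
      \<open>1 + 2 * u * t / a + D / (a * b) * t\<^sup>2\<close>, which is bounded below by the
      square of \<open>1 + u / a * t\<close>.\<close>
    define a b where "a = real k + 1" and "b = real k + 2"
    have ab: "a > 0" "b > 0" "b = a + 1" by (auto simp: a_def b_def)
    have "u\<^sup>2 * b \<le> D * a"
      using assms unfolding ab(3) D_def u_def v_def a_def by (simp add: algebra_simps)
    then have "(u / a)\<^sup>2 \<le> D / (a * b)"
      using divide_right_mono[of "u\<^sup>2 * b" "D * a" "a\<^sup>2 * b"] ab(1,2)
      by (simp add: power2_eq_square)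
    moreover have "(1 + u / a * t)\<^sup>2 = 1 + 2 * u * t / a + (u / a)\<^sup>2 * t\<^sup>2"
      by (simp add: power2_sum power_mult_distrib power_divide mult.assoc)
    ultimately have "(1 + u / a * t)\<^sup>2 \<le> 1 + 2 * u * t / a + D / (a * b) * t\<^sup>2"
      using mult_right_mono[of "(u / a)\<^sup>2" "D / (a * b)" "t\<^sup>2"]
      by simp
    then have "0 \<le> 1 + 2 * u * t / a + D / (a * b) * t\<^sup>2"
      using zero_le_power2 order_trans by blast
    then have "0 \<le> t ^ k / fact k * (1 + 2 * u * t / a + D / (a * b) * t\<^sup>2)"
      using that by (intro mult_nonneg_nonneg) auto
    also have "\<dots> = ?h t"
    proof -
      have "t ^ Suc k / fact (Suc k) = (t ^ k / fact k) * (t / a)"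
        "t ^ Suc (Suc k) / fact (Suc (Suc k)) = (t ^ k / fact k) * (t / a * (t / b))"
        by (simp_all add: a_def b_def ac_simps)
      then show ?thesis
        by (simp only:) (simp add: power2_eq_square ring_distribs mult_ac)
    qed
    finally show ?thesis .
  qed
  show ?thesis
    unfolding positive_transform_def eq using tp nonneg by blast
qed

text \<open>Induction on the number of zeros, removing one real zero or one conjugate pair at a
  time. The exponent \<open>N\<close> is chosen before \<open>p\<close> and depends only on the
  bound \<open>B\<close>; this uniformity allows \<open>p\<close> to move while the number of poles
  stays fixed.\<close>

lemma positive_transform_prod_zeros:
  fixes Z :: "complex multiset"
  assumes "image_mset cnj Z = Z" "K \<ge> 0"
  shows "\<exists>N. \<forall>p. \<bar>p\<bar> \<le> B \<longrightarrow> (\<forall>x. of_real x \<in># Z \<longrightarrow> x \<le> p) \<longrightarrow>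
            positive_transform (\<lambda>w. of_real K * w ^ N * (\<Prod>z\<in>#Z. 1 + (of_real p - z) * w))"
  using assms(1)
proof (induction "size Z" arbitrary: Z rule: less_induct)
  case less
  show ?case
  proof (cases "Z = {#}")
    case True
    show ?thesis
      using positive_transform_monom[OF assms(2), of 0] by (intro exI[of _ 1]) (simp add: True)
  next
    case False
    then obtain z Z' where Z: "Z = add_mset z Z'" by (metis multiset_cases)
    show ?thesis
    proof (cases "Im z = 0")
      case True
      then have z: "z = of_real (Re z)" by (simp add: complex_eq_iff)
      have "cnj z = z" using True by (simp add: complex_eq_iff)
      then have "image_mset cnj Z' = Z'"
        using less.prems unfolding Z by simp
      then obtain N where N: "\<And>p. \<bar>p\<bar> \<le> B \<Longrightarrow> (\<forall>x. of_real x \<in># Z' \<longrightarrow> x \<le> p) \<Longrightarrow>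
            positive_transform (\<lambda>w. of_real K * w ^ N * (\<Prod>z\<in>#Z'. 1 + (of_real p - z) * w))"
        using less.hyps[of Z'] Z by auto
      show ?thesis
      proof (intro exI[of _ "Suc N"] allI impI)
        fix p assume p: "\<bar>p\<bar> \<le> B" "\<forall>x. of_real x \<in># Z \<longrightarrow> x \<le> p"
        have "Re z \<le> p" using p(2) z unfolding Z by (metis union_single_eq_member)
        from positive_transform_mult[OF N positive_transform_real_zero[OF this], of p] p z
        show "positive_transform (\<lambda>w. of_real K * w ^ Suc N * (\<Prod>z\<in>#Z. 1 + (of_real p - z) * w))"
          by (simp add: Z mult_ac)
      qed
    next
      case False
      then have "cnj z \<noteq> z" by (simp add: complex_eq_iff)
      \<comment> \<open>The conjugate is a second, distinct member, so removing both leaves a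
        multiset closed under conjugation.\<close>
      have "cnj z \<in># Z"
        using less.prems unfolding Z by (metis image_mset_add_mset union_single_eq_member)
      then obtain Z'' where Z'': "Z' = add_mset (cnj z) Z''"
        using \<open>cnj z \<noteq> z\<close> unfolding Z by (metis insert_noteq_member mset_add)
      have "image_mset cnj Z'' = Z''"
        using less.prems unfolding Z Z'' by (simp add: add_mset_commute)
      then obtain N where N: "\<And>p. \<bar>p\<bar> \<le> B \<Longrightarrow> (\<forall>x. of_real x \<in># Z'' \<longrightarrow> x \<le> p) \<Longrightarrow>
            positive_transform (\<lambda>w. of_real K * w ^ N * (\<Prod>z\<in>#Z''. 1 + (of_real p - z) * w))"
        using less.hyps[of Z''] Z Z'' by auto
      obtain k :: nat where k: "(B + \<bar>Re z\<bar>)\<^sup>2 / (Im z)\<^sup>2 \<le> real k"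
        using real_arch_simple by blast
      show ?thesis
      proof (intro exI[of _ "Suc k + N"] allI impI)
        fix p assume p: "\<bar>p\<bar> \<le> B" "\<forall>x. of_real x \<in># Z \<longrightarrow> x \<le> p"
        have "(p - Re z)\<^sup>2 \<le> (B + \<bar>Re z\<bar>)\<^sup>2"
          using p(1) by (intro abs_le_square_iff[THEN iffD1]) linarith
        also have "\<dots> \<le> (Im z)\<^sup>2 * real k"
          using k False by (simp add: field_simps)
        also have "\<dots> \<le> (Im z)\<^sup>2 * (real k + 1)"
          by (rule mult_left_mono) auto
        finally have "(p - Re z)\<^sup>2 \<le> (Im z)\<^sup>2 * (real k + 1)" .
        from positive_transform_mult[OF N positive_transform_conjugate_zeros[OF this], of p] p
        show "positive_transform (\<lambda>w. of_real K * w ^ (Suc k + N) * (\<Prod>z\<in>#Z. 1 + (of_real p - z) * w))"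
          by (simp add: Z Z'' power_add mult_ac)
      qed
    qed
  qed
qed

section \<open>Transfer functions with a single multiple real pole\<close>

text \<open>Each zero factor is \<open>s - z = (s - p) * (1 + (p - z) / (s - p))\<close>, and its
  \<open>s - p\<close> cancels one pole.\<close>

lemma transfer_fun_multiple_pole:
  assumes "s \<noteq> p" "length zs \<le> n"
  shows "transfer_fun K zs (replicate n p) s =
           of_real K * (1 / (s - p)) ^ (n - length zs) * (\<Prod>z\<in>#mset zs. 1 + (p - z) * (1 / (s - p)))"
proof -
  define w where "w = s - p"
  have w: "w \<noteq> 0" using assms by (simp add: w_def)
  have "(\<Prod>z\<leftarrow>zs. s - z) = w ^ length zs * (\<Prod>z\<in>#mset zs. 1 + (p - z) * (1 / w))"
    by (induction zs) (use w in \<open>auto simp: w_def field_simps\<close>)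
  moreover have "(\<Prod>q\<leftarrow>replicate n p. s - q) = w ^ (n - length zs) * w ^ length zs"
    using assms by (simp add: w_def map_replicate_const prod_list_replicate flip: power_add)
  ultimately show ?thesis
    using w unfolding transfer_fun_def w_def[symmetric] by (simp add: power_one_over)
qed

lemma externally_positive_multiple_pole:
  assumes "conj_closed zs" "K \<ge> 0"
  shows "\<exists>N. \<forall>p n. \<bar>p\<bar> \<le> B \<longrightarrow> (\<forall>x. of_real x \<in> set zs \<longrightarrow> x \<le> p) \<longrightarrow> n \<ge> N \<longrightarrow>
            externally_positive (transfer_fun K zs (replicate n (of_real p)))"
proof -
  have "image_mset cnj (mset zs) = mset zs"
    using assms(1) by (simp add: conj_closed_def)
  from positive_transform_prod_zeros[OF this assms(2), of B, unfolded set_mset_mset] obtain N where N: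
    "\<And>p. \<bar>p\<bar> \<le> B \<Longrightarrow> (\<forall>x. of_real x \<in> set zs \<longrightarrow> x \<le> p) \<Longrightarrow>
       positive_transform (\<lambda>w. of_real K * w ^ N * (\<Prod>z\<in>#mset zs. 1 + (of_real p - z) * w))"
    by blast
  show ?thesis
  \<comment> \<open>\<open>N\<close> is the required excess of poles over zeros; any further excess
    \<open>j\<close> enters as a factor \<open>w ^ j\<close>.\<close>
  proof (intro exI[of _ "N + length zs"] allI impI)
    fix p n assume p: "\<bar>p\<bar> \<le> B" "\<forall>x. of_real x \<in> set zs \<longrightarrow> x \<le> p" and n: "n \<ge> N + length zs"
    obtain j where j: "n = length zs + (N + j)"
      using n by (auto simp: le_iff_add)
    define F where "F = (\<lambda>w. of_real K * w ^ N * (\<Prod>z\<in>#mset zs. 1 + (of_real p - z) * w) * w ^ j)"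
    obtain h where h: "transform_pair h F" "\<forall>t\<ge>0. h t \<ge> 0"
      using positive_transform_mult_power[OF N[OF p]] unfolding F_def positive_transform_def by blast
    have "transfer_fun K zs (replicate n (of_real p)) s = F (1 / (s - of_real p))" if "Re s > p" for s
    proof -
      have "s \<noteq> of_real p" using that by auto
      then show ?thesis
        unfolding F_def j by (subst transfer_fun_multiple_pole) (auto simp: power_add mult_ac)
    qed
    then have "has_laplace_transform (\<lambda>t. exp (p * t) * h t) (transfer_fun K zs (replicate n (of_real p)))"
      using transform_pair_laplace[OF h(1)] unfolding has_laplace_transform_def by (intro exI[of _ p]) simp
    then show "externally_positive (transfer_fun K zs (replicate n (of_real p)))"
      unfolding externally_positive_def is_impulse_response_def
      using h(2) transform_pair_continuous_on[OF h(1)]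
      by (intro exI[of _ "\<lambda>t. exp (p * t) * h t"]) (auto intro!: continuous_intros)
  qed
qed

section \<open>Landau's argument for nonnegative functions\<close>

text \<open>A power series with a nonzero coefficient that vanishes at \<open>0\<close> has no other
  zero near \<open>0\<close>, whereas this one vanishes at all small positive reals.\<close>

lemma powser_eq_zero_on_interval:
  fixes a :: "nat \<Rightarrow> complex"
  assumes "d > 0" and sum: "\<And>x::real. 0 \<le> x \<Longrightarrow> x < d \<Longrightarrow> (\<lambda>n. a n * of_real x ^ n) sums 0"
  shows "a n = 0"
proof (rule ccontr)
  assume n: "a n \<noteq> 0"
  have a0: "a 0 = 0"
    using sum[of 0] assms(1) sums_unique2[OF powser_sums_zero[of a]] by (simp add: power_0_left)
  then have "n > 0" using n by (cases n) auto
  define f where "f = (\<lambda>z. \<Sum>n. a n * z ^ n)"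
  have "summable (\<lambda>n. a n * of_real (d / 2) ^ n)"
    using sum[of "d / 2"] assms(1) sums_summable by force
  then have "(\<lambda>n. a n * (z - 0) ^ n) sums f z" if "norm (z - 0) < d / 2" for z
    unfolding f_def using that powser_inside[of a "of_real (d / 2)" z] assms(1)
    by (simp add: summable_sums)
  moreover have "f 0 = 0" using a0 by (simp add: f_def)
  ultimately obtain s where s: "s > 0" "\<And>z. z \<in> cball 0 s - {0} \<Longrightarrow> f z \<noteq> 0"
    using powser_0_nonzero[of "d / 2" 0 a f n] assms(1) n \<open>n > 0\<close> by (metis half_gt_zero)
  \<comment> \<open>A positive point inside both the zero-free punctured ball and the interval where
    the sum is zero.\<close>
  define x where "x = min s (d / 2)"
  have "f (of_real x) = 0"
    using sum[of x] s(1) assms(1) unfolding f_def x_def by (auto simp: sums_iff)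
  moreover have "of_real x \<in> cball (0::complex) s - {0}"
    using s(1) assms(1) by (auto simp: x_def)
  ultimately show False using s(2) by blast
qed

text \<open>At a real argument the integrand is real, and \<open>Re\<close> and \<open>Im\<close>
  commute with the integral.\<close>

lemma laplace_transform_on_reals:
  assumes "((\<lambda>t. exp (- (complex_of_real s * of_real t)) * of_real (h t)) has_integral F) S"
  shows "((\<lambda>t. exp (- (s * t)) * h t) has_integral Re F) S" "Im F = 0"
proof -
  have eq: "exp (- (complex_of_real s * of_real t)) * of_real (h t) = of_real (exp (- (s * t)) * h t)" for t
    by (simp flip: exp_of_real)
  note 1 = assms[unfolded eq]
  show "((\<lambda>t. exp (- (s * t)) * h t) has_integral Re F) S"
    using has_integral_linear[OF 1 bounded_linear_Re] by (simp add: o_def)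
  have "((\<lambda>t. 0) has_integral Im F) S"
    using has_integral_linear[OF 1 bounded_linear_Im] by (simp add: o_def)
  then show "Im F = 0" by (metis has_integral_0 has_integral_unique)
qed

text \<open>The point \<open>s0 - x\<close> may lie to the left of the half-plane in which the integral is assumed to
  converge; this is the content of Landau's theorem on the abscissa of convergence.\<close>

theorem laplace_transform_nonneg_antimono:
  fixes h :: "real \<Rightarrow> real"
  assumes L: "\<And>s. Re s > a \<Longrightarrow>
      ((\<lambda>t. exp (- (s * of_real t)) * of_real (h t)) has_integral F s) {0..}"
    and h: "\<And>t. t \<ge> 0 \<Longrightarrow> h t \<ge> 0"
    and hol: "F holomorphic_on ball (of_real s0) r"
    and s0: "s0 > a" and x: "0 \<le> x" "x < r"
  shows "Re (F (of_real s0)) \<le> Re (F (of_real (s0 - x)))"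
proof -
  \<comment> \<open>With the weight at \<open>s0\<close> absorbed into \<open>g\<close>, moving left
    by \<open>y\<close> means multiplying by \<open>exp (y * t)\<close>.\<close>
  define g where "g = (\<lambda>t. exp (- (s0 * t)) * h t)"
  have g: "g t \<ge> 0" if "t \<ge> 0" for t using h[OF that] by (simp add: g_def)
  have L': "((\<lambda>t. exp (y * t) * g t) has_integral Re (F (of_real (s0 - y)))) {0..}"
    "Im (F (of_real (s0 - y))) = 0" if "y < s0 - a" for y
  proof -
    have "Re (of_real (s0 - y)) > a" using that by simp
    note * = laplace_transform_on_reals[OF L[OF this]]
    have "exp (- ((s0 - y) * t)) * h t = exp (y * t) * g t" for t
      by (simp add: g_def algebra_simps flip: exp_add)
    with * show "((\<lambda>t. exp (y * t) * g t) has_integral Re (F (of_real (s0 - y)))) {0..}"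
      "Im (F (of_real (s0 - y))) = 0" by simp_all
  qed
  have g_meas: "g \<in> borel_measurable (lebesgue_on {0..})"
    using L'(1)[of 0] s0 by (intro integrable_imp_measurable) (auto intro: has_integral_integrable)
  have int: "(\<lambda>t. t ^ k / fact k * g t) integrable_on {0..}" for k
  proof -
    \<comment> \<open>\<open>s0 - d\<close> still lies to the right of \<open>a\<close>, so
      \<open>exp (d * t) * g t\<close> is integrable; up to a constant it dominates every moment
      integrand.\<close>
    define d where "d = (s0 - a) / 2"
    have d: "d > 0" "d < s0 - a" using s0 by (auto simp: d_def)
    show ?thesis
    proof (rule measurable_bounded_by_integrable_imp_integrable)
      have "(\<lambda>t. t ^ k / fact k :: real) \<in> borel_measurable (lebesgue_on {0..})"
        by (intro continuous_imp_measurable_on_sets_lebesgue continuous_intros) auto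
      then show "(\<lambda>t. t ^ k / fact k * g t) \<in> borel_measurable (lebesgue_on {0..})"
        using g_meas by (rule borel_measurable_times)
      show "(\<lambda>t. 1 / d ^ k * (exp (d * t) * g t)) integrable_on {0..}"
        using has_integral_mult_right[OF L'(1)[OF d(2)]] by (blast intro: has_integral_integrable)
      fix t :: real assume "t \<in> {0..}"
      then have t: "t \<ge> 0" by simp
      have "(d * t) ^ k / fact k \<le> exp (d * t)"
        using d t by (intro power_div_fact_le_exp) auto
      then have "t ^ k / fact k \<le> exp (d * t) / d ^ k"
        using d by (simp add: field_simps power_mult_distrib)
      from mult_right_mono[OF this g[OF t]]
      show "norm (t ^ k / fact k * g t) \<le> 1 / d ^ k * (exp (d * t) * g t)"
        using t g[OF t] by simp
    qed auto
  qed
  define c where "c k = integral {0..} (\<lambda>t. t ^ k / fact k * g t)" for k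
  have c: "c k \<ge> 0" for k
    unfolding c_def using int g by (intro integral_nonneg) auto
  \<comment> \<open>Expand \<open>exp (y * t)\<close> in its series; all terms are nonnegative, so
    monotone convergence exchanges sum and integral.\<close>
  have c_sums: "(\<lambda>k. c k * y ^ k) sums Re (F (of_real (s0 - y)))" if y: "0 \<le> y" "y < s0 - a" for y
  proof -
    let ?f = "\<lambda>n t. \<Sum>k<n. y ^ k * (t ^ k / fact k * g t)"
    have I: "(?f n has_integral (\<Sum>k<n. y ^ k * c k)) {0..}" for n
      unfolding c_def by (intro has_integral_sum has_integral_mult_right integrable_integral int) auto
    have lim: "(\<lambda>n. ?f n t) \<longlonglongrightarrow> exp (y * t) * g t" if "t \<in> {0..}" for t
    proof -
      have "(\<lambda>k. (y * t) ^ k / fact k * g t) sums (exp (y * t) * g t)"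
        using exp_converges[of "y * t"] by (intro sums_mult2) (simp add: field_simps)
      then show ?thesis
        by (simp add: sums_def power_mult_distrib mult_ac)
    qed
    have mono: "?f n t \<le> ?f m t" if "t \<in> {0..}" "n \<le> m" for n m t
    proof (rule sum_mono2)
      show "0 \<le> y ^ k * (t ^ k / fact k * g t)" for k using that y g by simp
    qed (use that in auto)
    have bound: "(\<Sum>k<n. y ^ k * c k) \<le> Re (F (of_real (s0 - y)))" for n
    proof (rule has_integral_le[OF I L'(1)[OF y(2)]])
      fix t :: real assume t: "t \<in> {0..}"
      show "?f n t \<le> exp (y * t) * g t"
        by (rule LIMSEQ_le_const[OF lim[OF t]]) (use mono[OF t] in blast)
    qed
    have "(\<lambda>t. exp (y * t) * g t) integrable_on {0..} \<and>
          (\<lambda>n. integral {0..} (?f n)) \<longlonglongrightarrow> integral {0..} (\<lambda>t. exp (y * t) * g t)"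
    proof (rule monotone_convergence_increasing)
      show "?f n integrable_on {0..}" for n using I by blast
      show "?f n t \<le> ?f (Suc n) t" if "t \<in> {0..}" for n t
        by (rule mono[OF that]) simp
      show "(\<lambda>n. ?f n t) \<longlonglongrightarrow> exp (y * t) * g t" if "t \<in> {0..}" for t by (rule lim[OF that])
      have "(\<Sum>k<n. y ^ k * c k) \<ge> 0" for n using c y by (intro sum_nonneg) auto
      then show "bounded (range (\<lambda>n. integral {0..} (?f n)))"
        unfolding integral_unique[OF I] using bound
        by (intro boundedI[of _ "Re (F (of_real (s0 - y)))"]) auto
    qed
    then show ?thesis
      unfolding integral_unique[OF I] integral_unique[OF L'(1)[OF y(2)]] by (simp add: sums_def mult_ac)
  qed
  \<comment> \<open>The Taylor coefficients of \<open>F\<close> at \<open>s0\<close> in the variable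
    \<open>y\<close> of \<open>s0 - y\<close>, hence the sign.\<close>
  define b where "b k = (deriv ^^ k) F (of_real s0) / fact k * (-1) ^ k" for k
  have b_sums: "(\<lambda>k. b k * of_real y ^ k) sums F (of_real (s0 - y))" if y: "0 \<le> y" "y < r" for y
  proof -
    have "of_real (s0 - y) \<in> ball (of_real s0 :: complex) r"
      using y by (simp add: dist_norm)
    from holomorphic_power_series[OF hol this]
    have "(\<lambda>k. (deriv ^^ k) F (of_real s0) / fact k * (- of_real y) ^ k) sums F (of_real (s0 - y))"
      by simp
    then show ?thesis
      by (simp add: b_def power_minus[of "of_real y"] mult_ac)
  qed
  \<comment> \<open>Both series represent \<open>F\<close> on a common interval to the left of
    \<open>s0\<close>. Thus the Taylor series, which converges on the whole ball, has the
    nonnegative moments as coefficients.\<close>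
  have eq: "b k = of_real (c k)" for k
  proof -
    have "b k - of_real (c k) = 0"
    proof (rule powser_eq_zero_on_interval)
      show "min r (s0 - a) > 0" using x s0 by auto
      fix y :: real assume y: "0 \<le> y" "y < min r (s0 - a)"
      have "F (of_real (s0 - y)) = of_real (Re (F (of_real (s0 - y))))"
        using L'(2) y by (simp add: complex_eq_iff)
      moreover have "(\<lambda>k. of_real (c k * y ^ k)) sums (of_real (Re (F (of_real (s0 - y)))) :: complex)"
        using c_sums y by (intro sums_of_real) auto
      ultimately show "(\<lambda>k. (b k - of_real (c k)) * of_real y ^ k) sums 0"
        using sums_diff[OF b_sums[of y]] y by (fastforce simp: algebra_simps)
    qed
    then show ?thesis by simp
  qed
  have sums: "(\<lambda>k. c k * x ^ k) sums Re (F (of_real (s0 - x)))"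
    using sums_Re[OF b_sums[OF x]] unfolding eq by (simp flip: of_real_power)
  have "(\<lambda>k. b k * 0 ^ k) sums F (of_real s0)"
    using b_sums[of 0] x by simp
  then have "Re (F (of_real s0)) = c 0"
    using sums_unique2[OF _ powser_sums_zero[of b]] eq by fastforce
  \<comment> \<open>Dropping all terms but the constant one can only decrease the nonnegative
    series.\<close>
  also have "\<dots> = (\<Sum>k\<in>{0}. c k * x ^ k)" by simp
  also have "\<dots> \<le> (\<Sum>k. c k * x ^ k)"
    using c x sums_summable[OF sums] by (intro sum_le_suminf) auto
  finally show ?thesis
    using sums_unique[OF sums] by simp
qed


section \<open>The lower bound by real zeros\<close>

lemma transfer_fun_holomorphic_on:
  assumes "S \<inter> set ps = {}"
  shows "transfer_fun K zs ps holomorphic_on S"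
proof -
  have prod: "(\<lambda>s. \<Prod>q\<leftarrow>qs. s - q) holomorphic_on S" for qs
    by (induction qs) (auto intro!: holomorphic_intros)
  have "(\<lambda>s. of_real K * (\<Prod>z\<leftarrow>zs. s - z) / (\<Prod>p\<leftarrow>ps. s - p)) holomorphic_on S"
    using assms by (intro holomorphic_on_divide holomorphic_on_mult holomorphic_on_const prod)
      (auto simp: prod_list_zero_iff)
  then show ?thesis
    by (simp add: transfer_fun_def[abs_def])
qed

text \<open>If a real zero \<open>x\<close> lay to the right of all poles, the pole-free ball about
  \<open>s0\<close> would contain it. Monotonicity would then give
  \<open>?F s0 \<le> ?F x = 0\<close>, so that \<open>?F s0 = 0\<close> although \<open>s0\<close>
  is not a zero.\<close>

lemma real_zero_le_pole_abscissa:
  assumes K: "K > 0" and zs: "\<forall>z\<in>set zs. z \<notin> complex_of_real ` {0..}"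
    and ps: "ps \<noteq> []" "\<forall>p\<in>set ps. Re p < 0"
    and pos: "externally_positive (transfer_fun K zs ps)"
    and x: "complex_of_real x \<in> set zs"
  shows "x \<le> pole_abscissa ps"
proof (rule ccontr)
  let ?F = "transfer_fun K zs ps"
  assume "\<not> x \<le> pole_abscissa ps"
  then have lt: "pole_abscissa ps < x" by simp
  have "x < 0" using zs x by (metis atLeast_iff image_eqI not_le)
  obtain h a where h: "\<And>t. t \<ge> 0 \<Longrightarrow> h t \<ge> 0"
    and L: "\<And>s. Re s > a \<Longrightarrow> ((\<lambda>t. exp (- (s * of_real t)) * of_real (h t)) has_integral ?F s) {0..}"
    using pos unfolding externally_positive_def is_impulse_response_def has_laplace_transform_def by blast
  \<comment> \<open>Being greater than \<open>a\<close>, \<open>s0\<close> lies where the integral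
    converges; being positive, it differs from all zeros and poles.\<close>
  define s0 where "s0 = \<bar>a\<bar> + 1"
  have s0: "s0 > a" "s0 > 0" by (auto simp: s0_def)
  have "Re p \<le> pole_abscissa ps" if "p \<in> set ps" for p
    using that unfolding pole_abscissa_def by simp
  moreover have "Re w > pole_abscissa ps" if "w \<in> ball (of_real s0) (s0 - pole_abscissa ps)" for w
    using that complex_Re_le_cmod[of "of_real s0 - w"] by (simp add: dist_norm)
  ultimately have "ball (of_real s0) (s0 - pole_abscissa ps) \<inter> set ps = {}"
    by force
  then have hol: "?F holomorphic_on ball (of_real s0) (s0 - pole_abscissa ps)"
    by (rule transfer_fun_holomorphic_on)
  have "Re (?F (of_real s0)) \<le> Re (?F (of_real (s0 - (s0 - x))))"
    by (rule laplace_transform_nonneg_antimono[OF L h hol s0(1)]) (use lt \<open>x < 0\<close> s0 in auto)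
  also have "?F (of_real (s0 - (s0 - x))) = 0"
    using x by (auto simp: transfer_fun_def prod_list_zero_iff)
  finally have le: "Re (?F (of_real s0)) \<le> 0" by simp
  note F = laplace_transform_on_reals[OF L[of "of_real s0"]]
  have "Re (?F (of_real s0)) \<ge> 0"
    by (rule has_integral_nonneg[OF F(1)]) (use s0 h in auto)
  with le F(2) s0 have "?F (of_real s0) = 0"
    by (simp add: complex_eq_iff)
  moreover have "of_real s0 \<notin> set zs" "of_real s0 \<notin> set ps"
    using zs ps(2) s0(2) by force+
  ultimately show False
    using K by (auto simp: transfer_fun_def prod_list_zero_iff)
qed

section \<open>The minimum and the limit of \<open>sigma_star\<close>\<close>

lemma sigma_star_le_multiple_pole:
  assumes "p < 0" "n > 0" "of_real p \<notin> set zs"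
    and "externally_positive (transfer_fun K zs (replicate n (of_real p)))"
  shows "sigma_star K zs n \<le> ereal p"
proof -
  have "replicate n (of_real p) \<in> admissible_poles K zs n"
    using assms by (auto simp: admissible_poles_def conj_closed_def)
  moreover have "pole_abscissa (replicate n (of_real p)) = p"
    using assms by (simp add: pole_abscissa_def)
  ultimately show ?thesis
    unfolding sigma_star_def by (metis INF_lower)
qed

theorem corollary3:
  fixes K :: real and zs :: "complex list"
  assumes "K > 0"
    and "conj_closed zs"
    and "\<forall>z\<in>set zs. z \<notin> complex_of_real ` {0..}"
  shows "((\<exists>x<0. complex_of_real x \<in> set zs) \<longrightarrow>
            (let M = ereal (Max {x. complex_of_real x \<in> set zs}) in
               (\<exists>n>length zs. sigma_star K zs n = M) \<and>
               (\<forall>n>length zs. M \<le> sigma_star K zs n))) \<and>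
         (\<not> (\<exists>x<0. complex_of_real x \<in> set zs) \<longrightarrow>
            (sigma_star K zs \<longlonglongrightarrow> -\<infinity>))"
proof (intro conjI impI)
  have neg: "x < 0" if "complex_of_real x \<in> set zs" for x
    using that assms(3) by (metis atLeast_iff image_eqI not_le)
  have K: "K \<ge> 0" using assms(1) by simp
  note mult = externally_positive_multiple_pole[OF assms(2) K]
  {
    assume "\<exists>x<0. complex_of_real x \<in> set zs"
    then have ne: "{x. complex_of_real x \<in> set zs} \<noteq> {}" by blast
    have fin: "finite {x. complex_of_real x \<in> set zs}"
      using finite_vimageI[of "set zs" complex_of_real] by (simp add: vimage_def inj_of_real)
    define M where "M = Max {x. complex_of_real x \<in> set zs}"
    have M: "complex_of_real M \<in> set zs"
      using Max_in[OF fin ne] by (simp add: M_def)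
    have M_ge: "x \<le> M" if "complex_of_real x \<in> set zs" for x
      using Max_ge[OF fin] that by (simp add: M_def)
    have lower: "ereal M \<le> sigma_star K zs n" if n: "n > length zs" for n
      unfolding sigma_star_def
    proof (rule INF_greatest)
      fix ps assume "ps \<in> admissible_poles K zs n"
      moreover from this have "ps \<noteq> []"
        using n by (auto simp: admissible_poles_def)
      ultimately show "ereal M \<le> ereal (pole_abscissa ps)"
        using real_zero_le_pole_abscissa[OF assms(1,3) _ _ _ M, of ps]
        by (simp add: admissible_poles_def)
    qed
    \<comment> \<open>Uniformity on \<open>\<bar>p\<bar> \<le> \<bar>M\<bar>\<close> fixes
      \<open>n\<close> before \<open>e\<close>, so the infimum for this single \<open>n\<close>
      reaches \<open>M\<close>.\<close>
    obtain N where N: "\<And>p n. \<bar>p\<bar> \<le> \<bar>M\<bar> \<Longrightarrow> \<forall>x. complex_of_real x \<in> set zs \<longrightarrow> x \<le> p \<Longrightarrow> n \<ge> N \<Longrightarrow>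
        externally_positive (transfer_fun K zs (replicate n (of_real p)))"
      using mult[of "\<bar>M\<bar>"] by blast
    define n where "n = max N (Suc (length zs))"
    have "sigma_star K zs n \<le> ereal M"
    proof (rule ereal_le_epsilon2)
      fix e :: real assume e: "0 < e"
      \<comment> \<open>Strictly above \<open>M\<close>, so that \<open>p\<close> is not a zero,
        within \<open>e\<close> of it, and still negative; hence also
        \<open>\<bar>p\<bar> \<le> \<bar>M\<bar>\<close>.\<close>
      define p where "p = M + min e (- M / 2)"
      have p: "M < p" "p < 0" "p \<le> M + e"
        using e neg[OF M] by (auto simp: p_def min_def field_simps)
      have "sigma_star K zs n \<le> ereal p"
      proof (rule sigma_star_le_multiple_pole)
        show "of_real p \<notin> set zs" using M_ge p(1) by force
        show "externally_positive (transfer_fun K zs (replicate n (of_real p)))"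
          using p M_ge by (intro N) (force simp: n_def)+
      qed (use p in \<open>auto simp: n_def\<close>)
      also have "\<dots> \<le> ereal M + ereal e" using p(3) by simp
      finally show "sigma_star K zs n \<le> ereal M + ereal e" .
    qed
    moreover have "n > length zs" by (simp add: n_def)
    ultimately show "let M = ereal (Max {x. complex_of_real x \<in> set zs}) in
               (\<exists>n>length zs. sigma_star K zs n = M) \<and>
               (\<forall>n>length zs. M \<le> sigma_star K zs n)"
      using lower unfolding Let_def M_def[symmetric] by (blast intro: antisym)
  }
  {
    assume "\<not> (\<exists>x<0. complex_of_real x \<in> set zs)"
    then have no_real: "complex_of_real x \<notin> set zs" for x using neg by blast
    show "sigma_star K zs \<longlonglongrightarrow> -\<infinity>"
      unfolding tendsto_MInfty
    proof
      fix r :: real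
      \<comment> \<open>Negative and strictly below \<open>r\<close>; without real zeros the pole
        may be placed this far left.\<close>
      define p where "p = min (r - 1) (- 1)"
      obtain N where N: "\<And>n. n \<ge> N \<Longrightarrow> externally_positive (transfer_fun K zs (replicate n (of_real p)))"
        using mult[of "\<bar>p\<bar>"] no_real by blast
      show "\<forall>\<^sub>F n in sequentially. sigma_star K zs n < ereal r"
        \<comment> \<open>The bound \<open>1\<close> makes the list of poles nonempty, so that its
          abscissa is \<open>p\<close>.\<close>
        using eventually_ge_at_top[of "max N 1"]
      proof eventually_elim
        case (elim n)
        then have "sigma_star K zs n \<le> ereal p"
          using no_real N by (intro sigma_star_le_multiple_pole) (auto simp: p_def)
        also have "ereal p < ereal r"
          unfolding less_ereal.simps by (simp add: p_def)
        finally show ?case .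
      qed
    qed
  }
qed

end
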